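(* Let $f=[f_1,\dots,f_m]^T:\mathbb{R}^n\to\mathbb{R}^m$ be continuously differentiable, let $x_k\in\mathbb{R}^n$ be a point with $\nabla f_i(x_k)\ne0$ for all $i\in\{1,\dots,m\}$, and let $0\le\eta<\frac12$. Then $$\|f'(x_k)\|_{2,\infty}^2\,h_2^2(G(x_k))\ \ge\ h_2^2(f'(x_k)),$$ and consequently $$1-\frac{1-2\eta}{1+\eta^2}\,\frac{h_2^2(G(x_k))}{m}\ \le\ 1-\frac{1-2\eta}{1+\eta^2}\,\frac{h_2^2(f'(x_k))}{\|f'(x_k)\|_{2,\infty}^2\,m}.$$
   Context: Notation: $f'(x)=[\nabla f_1(x),\dots,\nabla f_m(x)]^T\in\mathbb{R}^{m\times n}$ is the Jacobian, and $G(x)=\left[\frac{\nabla f_1(x)}{\|\nabla f_1(x)\|_2},\dots,\frac{\nabla f_m(x)}{\|\nabla f_m(x)\|_2}\right]^T\in\mathbb{R}^{m\times n}$. For a matrix $A$ with rows $A^{(i)}$, $h_2(A)=\inf_{x\ne0}\|Ax\|_2/\|x\|_2$ and $\|A\|_{2,\infty}=\max_i\|A^{(i)}\|_2$. *)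

theory Defs
  imports "HOL-Analysis.Analysis"
begin

definition continuously_differentiable ::
    "('a::real_normed_vector \<Rightarrow> 'b::real_normed_vector) \<Rightarrow> bool" where
  "continuously_differentiable f \<longleftrightarrow>
     (\<exists>f' :: 'a \<Rightarrow> 'a \<Rightarrow>\<^sub>L 'b.
        (\<forall>x. (f has_derivative blinfun_apply (f' x)) (at x)) \<and> continuous_on UNIV f')"

definition grad :: "('a::real_inner \<Rightarrow> real) \<Rightarrow> 'a \<Rightarrow> 'a" where
  "grad g x = (THE D. GDERIV g x :> D)"

lemma grad_eqI:
  assumes "GDERIV g x :> D"
  shows "grad g x = D"
  unfolding grad_def
proof (rule the_equality)
  fix E assume "GDERIV g x :> E"
  then have "(\<lambda>h. inner h E) = (\<lambda>h. inner h D)"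
    using assms unfolding gderiv_def by (rule has_derivative_unique)
  then have "inner (E - D) E = inner (E - D) D" by meson
  then have "inner (E - D) (E - D) = 0" by (simp add: inner_diff_right)
  then show "E = D" by simp
qed (fact assms)

(* The library's Jacobian is the matrix whose rows are the gradients of the components. *)
lemma jacobian_eq_grad:
  fixes f :: "real ^ 'n \<Rightarrow> real ^ 'm"
  assumes "f differentiable at x"
  shows "jacobian f (at x) = (\<chi> i. grad (\<lambda>y. f y $ i) x)"
proof -
  have d: "(f has_derivative (\<lambda>h. jacobian f (at x) *v h)) (at x)"
    using assms by (simp add: jacobian_works)
  have "grad (\<lambda>y. f y $ i) x = jacobian f (at x) $ i" for i
  proof (rule grad_eqI)
    have "((\<lambda>y. f y $ i) has_derivative (\<lambda>h. (jacobian f (at x) *v h) $ i)) (at x)"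
      using bounded_linear.has_derivative[OF bounded_linear_vec_nth d] .
    moreover have "(\<lambda>h. (jacobian f (at x) *v h) $ i) = (\<lambda>h. inner h (jacobian f (at x) $ i))"
      by (simp add: matrix_vector_mul_component inner_commute)
    ultimately show "GDERIV (\<lambda>y. f y $ i) x :> jacobian f (at x) $ i"
      by (simp add: gderiv_def)
  qed
  then show ?thesis by (simp add: vec_eq_iff)
qed

definition normalized_jacobian ::
    "(real ^ 'n \<Rightarrow> real ^ 'm) \<Rightarrow> real ^ 'n \<Rightarrow> real ^ 'n ^ 'm" where
  "normalized_jacobian f x =
     (\<chi> i. grad (\<lambda>y. f y $ i) x /\<^sub>R norm (grad (\<lambda>y. f y $ i) x))"

definition h2 :: "real ^ 'n ^ 'm \<Rightarrow> real" where
  "h2 A = (INF x \<in> {x. x \<noteq> 0}. norm (A *v x) / norm x)"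

definition norm_2_inf :: "real ^ 'n ^ 'm \<Rightarrow> real" where
  "norm_2_inf A = Max (range (\<lambda>i. norm (row i A)))"

end

theory Submission
  imports Defs
begin

text \<open>Each row of \<open>f'(x_k)\<close> is the corresponding row of \<open>G(x_k)\<close>
  scaled by its own norm, and that norm is at most \<open>norm_2_inf\<close> of the Jacobian. So for
  every x the components of \<open>f'(x_k) x\<close> are bounded by this constant times those of
  \<open>G(x_k) x\<close>, and hence so are the Euclidean norms
  (\<open>norm_mult_le_norm_2_inf_normalized\<close>). Dividing by the norm of x and passing to
  infima gives the same bound between the two values of \<open>h2\<close>
  (\<open>h2_le_mult_h2\<close>). Squaring yields the first inequality; the second is a
  rearrangement of it, because the coefficient in \<eta> is nonnegative.\<close>

lemma nonzero_vec_nonempty: "{x :: real ^ 'n. x \<noteq> 0} \<noteq> {}"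
proof -
  have "axis undefined 1 \<noteq> (0 :: real ^ 'n)"
    by (simp add: axis_eq_0_iff)
  then show ?thesis by blast
qed

text \<open>Zero is a lower bound of all the quotients. It passes to the real infimum because the
  quotients form a nonempty set: the index type is inhabited, so a nonzero vector exists.\<close>

lemma h2_nonneg: "0 \<le> h2 (A :: real ^ 'n ^ 'm)"
  unfolding h2_def using nonzero_vec_nonempty by (intro cINF_greatest) auto

lemma h2_le:
  fixes A :: "real ^ 'n ^ 'm"
  assumes "x \<noteq> 0"
  shows "h2 A \<le> norm (A *v x) / norm x"
  unfolding h2_def using assms by (intro cINF_lower bdd_belowI[where m = 0]) auto

text \<open>Since c is positive it can be moved to the other side: \<open>h2 A / c\<close> is then a
  lower bound of every quotient of B, hence of their infimum.\<close>

lemma h2_le_mult_h2: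
  fixes A :: "real ^ 'n ^ 'm" and B :: "real ^ 'n ^ 'k"
  assumes "c > 0" and le: "\<And>x. norm (A *v x) \<le> c * norm (B *v x)"
  shows "h2 A \<le> c * h2 B"
proof -
  have "h2 A / c \<le> norm (B *v x) / norm x" if "x \<noteq> 0" for x
  proof -
    have "h2 A \<le> norm (A *v x) / norm x"
      using that by (rule h2_le)
    also have "\<dots> \<le> c * norm (B *v x) / norm x"
      by (intro divide_right_mono le) simp
    finally show ?thesis
      using \<open>c > 0\<close> by (simp add: pos_divide_le_eq mult.commute)
  qed
  then have "h2 A / c \<le> h2 B"
    unfolding h2_def[of B] using nonzero_vec_nonempty by (intro cINF_greatest) auto
  then show ?thesis
    using \<open>c > 0\<close> by (simp add: pos_divide_le_eq mult.commute)
qed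

lemma norm_row_le_norm_2_inf: "norm (A $ i) \<le> norm_2_inf A"
  unfolding norm_2_inf_def by (rule Max_ge) (auto simp: row_def)

lemma norm_2_inf_pos:
  assumes "A $ i \<noteq> 0"
  shows "0 < norm_2_inf A"
  using norm_row_le_norm_2_inf[of A i] assms by (meson less_le_trans zero_less_norm_iff)

text \<open>Undoing the normalization costs each component a factor equal to the norm of its row,
  and the largest row norm bounds all these factors at once.\<close>

lemma norm_mult_le_norm_2_inf_normalized:
  fixes A :: "real ^ 'n ^ 'm"
  shows "norm (A *v x) \<le> norm_2_inf A * norm ((\<chi> i. A $ i /\<^sub>R norm (A $ i)) *v x)"
    (is "_ \<le> _ * norm (?B *v x)")
proof -
  have nonneg: "0 \<le> norm_2_inf A"
    using norm_row_le_norm_2_inf[of A] norm_ge_zero order_trans by blast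
  \<comment> \<open>With the constant moved inside the norm, it suffices to compare absolute values
    component by component.\<close>
  have "norm (A *v x) \<le> norm (norm_2_inf A *\<^sub>R (?B *v x))"
  proof (rule norm_le_componentwise_cart)
    fix i
    \<comment> \<open>For a nonzero row the norm cancels its inverse; for a zero row both sides
      vanish.\<close>
    have "norm ((A *v x) $ i) = norm (A $ i) * norm ((?B *v x) $ i)"
      by (cases "A $ i = 0") (simp_all add: matrix_vector_mul_component abs_mult)
    also have "\<dots> \<le> norm_2_inf A * norm ((?B *v x) $ i)"
      by (intro mult_right_mono norm_row_le_norm_2_inf) simp
    finally show "norm ((A *v x) $ i) \<le> norm ((norm_2_inf A *\<^sub>R (?B *v x)) $ i)"
      using nonneg by (simp add: abs_mult)
  qed
  then show ?thesis using nonneg by simp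
qed

theorem mainTheorem8:
  fixes f :: "real ^ 'n \<Rightarrow> real ^ 'm"
    and xk :: "real ^ 'n"
    and \<eta> :: real
  assumes "continuously_differentiable f"
    and "\<And>i. grad (\<lambda>y. f y $ i) xk \<noteq> 0"
    and "0 \<le> \<eta>" and "\<eta> < 1 / 2"
  shows "(norm_2_inf (jacobian f (at xk)))\<^sup>2 * (h2 (normalized_jacobian f xk))\<^sup>2 \<ge> (h2 (jacobian f (at xk)))\<^sup>2
       \<and> 1 - (1 - 2 * \<eta>) / (1 + \<eta>\<^sup>2) * ((h2 (normalized_jacobian f xk))\<^sup>2 / real CARD('m))
         \<le> 1 - (1 - 2 * \<eta>) / (1 + \<eta>\<^sup>2) *
               ((h2 (jacobian f (at xk)))\<^sup>2 / ((norm_2_inf (jacobian f (at xk)))\<^sup>2 * real CARD('m)))"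
proof -
  let ?J = "jacobian f (at xk)" and ?G = "normalized_jacobian f xk"
  have "f differentiable at xk"
    using assms(1) unfolding continuously_differentiable_def differentiable_def by blast
  then have J: "?J $ i = grad (\<lambda>y. f y $ i) xk" for i
    by (simp add: jacobian_eq_grad)
  then have G: "?G = (\<chi> i. ?J $ i /\<^sub>R norm (?J $ i))"
    by (simp add: normalized_jacobian_def)
  \<comment> \<open>A single nonzero gradient makes the largest row norm positive, which later
    permits dividing by it.\<close>
  have pos: "0 < norm_2_inf ?J"
    using assms(2) J by (metis norm_2_inf_pos)
  have "h2 ?J \<le> norm_2_inf ?J * h2 ?G"
    unfolding G using pos norm_mult_le_norm_2_inf_normalized by (rule h2_le_mult_h2)
  \<comment> \<open>Squaring preserves the order because \<open>h2\<close> of the Jacobian is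
    nonnegative.\<close>
  then have sq: "(h2 ?J)\<^sup>2 \<le> (norm_2_inf ?J)\<^sup>2 * (h2 ?G)\<^sup>2"
    using power_mono[OF _ h2_nonneg] by (metis power_mult_distrib)
  then have "(h2 ?J)\<^sup>2 / (norm_2_inf ?J)\<^sup>2 \<le> (h2 ?G)\<^sup>2"
    using pos by (simp add: pos_divide_le_eq mult.commute)
  then have "(h2 ?J)\<^sup>2 / ((norm_2_inf ?J)\<^sup>2 * real CARD('m)) \<le> (h2 ?G)\<^sup>2 / real CARD('m)"
    using divide_right_mono[of _ _ "real CARD('m)"] by fastforce
  \<comment> \<open>Here \<eta> < 1/2 enters: the sign of the coefficient lets the bound be
    multiplied by it and then subtracted from 1, which reverses the order.\<close>
  moreover have "0 \<le> (1 - 2 * \<eta>) / (1 + \<eta>\<^sup>2)"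
    using assms(4) by simp
  ultimately show ?thesis
    using sq by (intro conjI diff_left_mono mult_left_mono)
qed

end
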